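(* Let $\|\cdot\|$ be a norm on $\mathbb{R}^d$ with associated sequence $\{\|\cdot\|^{\mathrm{tn}}_{\star,(j)}\}_{j\in\{1,\ldots,d\}}$ of generalized top-$k$ dual norms, and with associated Capra coupling ¢. (1) If the norm $\|\cdot\|$ is orthant-monotonic, then for any function $\varphi:\{0,1,\ldots,d\}\to\mathbb{R}$, $$(\varphi\circ\ell_0)^{¢}=\sup_{j\in\{0,1,\ldots,d\}}\big[\|\cdot\|^{\mathrm{tn}}_{\star,(j)}-\varphi(j)\big],$$ with the convention $\|\cdot\|^{\mathrm{tn}}_{\star,(0)}=0$. (2) If both the norm $\|\cdot\|$ and the dual norm $\|\cdot\|_\star$ are orthant-strictly monotonic, then for any nondecreasing function $\varphi:\{0,1,\ldots,d\}\to\mathbb{R}$, $$(\varphi\circ\ell_0)^{¢¢'}=\varphi\circ\ell_0.$$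
   Context: $\mathbb{R}^d$ ($d\ge1$) is equipped with the scalar product $\langle\cdot,\cdot\rangle$ (the source norm $\|\cdot\|$ need not be Euclidean). $\ell_0(x)$ is the number of nonzero components of $x\in\mathbb{R}^d$. The dual norm is $\|y\|_\star=\sup_{\|x\|\le1}\langle x,y\rangle$. A norm $N$ on $\mathbb{R}^d$ is orthant-monotonic if, for all $x,x'\in\mathbb{R}^d$ with $|x_i|\le|x'_i|$ and $x_ix'_i\ge0$ for all $i$, one has $N(x)\le N(x')$. It is orthant-strictly monotonic if, for all $x,x'$ with $|x_i|\le|x'_i|$ for all $i$, $|x_j|<|x'_j|$ for some $j$, and $x_ix'_i\ge0$ for all $i$, one has $N(x)<N(x')$. Generalized top-$k$ dual norm: for $k\in\{1,\ldots,d\}$, $\|y\|^{\mathrm{tn}}_{\star,(k)}=\sup_{K\subset\{1,\ldots,d\},\,|K|\le k}\|y_K\|_\star$, where $y_K\in\mathbb{R}^d$ coincides with $y$ on $K$ and vanishes outside $K$. Capra coupling: ¢$(x,y)=\langle x,y\rangle/\|x\|$ if $x\neq0$, and ¢$(0,y)=0$. The Moreau lower addition $\dot{+}$ extends the usual addition to $\overline{\mathbb{R}}=[-\infty,+\infty]$ with $(+\infty)\dot{+}(-\infty)=(-\infty)\dot{+}(+\infty)=-\infty$. For $f:\mathbb{R}^d\to\overline{\mathbb{R}}$, the ¢-conjugate is $f^{¢}(y)=\sup_{x\in\mathbb{R}^d}(¢(x,y)\dot{+}(-f(x)))$ and the ¢-biconjugate is $f^{¢¢'}(x)=\sup_{y\in\mathbb{R}^d}(¢(x,y)\dot{+}(-f^{¢}(y)))$.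 *)

theory Defs
  imports "HOL-Analysis.Analysis"
begin

text \<open>An arbitrary norm on a real vector space, as opposed to the fixed norm of the
  type class \<open>real_normed_vector\<close>, which on \<open>real ^ 'n\<close> is Euclidean.\<close>

definition is_norm :: "('a::real_vector \<Rightarrow> real) \<Rightarrow> bool" where
  "is_norm N \<longleftrightarrow>
     (\<forall>x. 0 \<le> N x) \<and>
     (\<forall>x. N x = 0 \<longleftrightarrow> x = 0) \<and>
     (\<forall>c x. N (c *\<^sub>R x) = \<bar>c\<bar> * N x) \<and>
     (\<forall>x y. N (x + y) \<le> N x + N y)"

definition l0 :: "real ^ 'n \<Rightarrow> nat" where
  "l0 x = card {i. x $ i \<noteq> 0}"

text \<open>When \<open>N\<close> is a norm, the supremum below is over a nonempty set that is bounded above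
  (finite dimension), so the supremum on \<open>real\<close> is the genuine one.\<close>

definition dual_norm :: "(real ^ 'n \<Rightarrow> real) \<Rightarrow> real ^ 'n \<Rightarrow> real" where
  "dual_norm N y = (SUP x\<in>{x. N x \<le> 1}. x \<bullet> y)"

definition orthant_monotonic :: "(real ^ 'n \<Rightarrow> real) \<Rightarrow> bool" where
  "orthant_monotonic N \<longleftrightarrow>
     (\<forall>x x'. (\<forall>i. \<bar>x $ i\<bar> \<le> \<bar>x' $ i\<bar>) \<and> (\<forall>i. x $ i * x' $ i \<ge> 0) \<longrightarrow> N x \<le> N x')"

definition orthant_strictly_monotonic :: "(real ^ 'n \<Rightarrow> real) \<Rightarrow> bool" where
  "orthant_strictly_monotonic N \<longleftrightarrow>
     (\<forall>x x'. (\<forall>i. \<bar>x $ i\<bar> \<le> \<bar>x' $ i\<bar>) \<and> (\<exists>j. \<bar>x $ j\<bar> < \<bar>x' $ j\<bar>) \<and>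
        (\<forall>i. x $ i * x' $ i \<ge> 0) \<longrightarrow> N x < N x')"

definition vec_restrict :: "'n set \<Rightarrow> real ^ 'n \<Rightarrow> real ^ 'n" where
  "vec_restrict K y = (\<chi> i. if i \<in> K then y $ i else 0)"

text \<open>The argument \<open>N\<close> is the source norm; its dual norm is taken inside the definition.
  The value at \<open>k = 0\<close> is a convention.\<close>

definition top_dual_norm :: "(real ^ 'n \<Rightarrow> real) \<Rightarrow> nat \<Rightarrow> real ^ 'n \<Rightarrow> real" where
  "top_dual_norm N k y =
     (if k = 0 then 0 else (SUP K\<in>{K. card K \<le> k}. dual_norm N (vec_restrict K y)))"

definition capra :: "(real ^ 'n \<Rightarrow> real) \<Rightarrow> real ^ 'n \<Rightarrow> real ^ 'n \<Rightarrow> real" where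
  "capra N x y = (if x = 0 then 0 else (x \<bullet> y) / N x)"

text \<open>Moreau lower addition. The library addition on \<open>ereal\<close> satisfies
  \<open>\<infinity> + (-\<infinity>) = \<infinity>\<close>, so it cannot be used directly.\<close>

definition lower_add :: "ereal \<Rightarrow> ereal \<Rightarrow> ereal" where
  "lower_add a b =
     (if (a = \<infinity> \<and> b = -\<infinity>) \<or> (a = -\<infinity> \<and> b = \<infinity>) then -\<infinity> else a + b)"

definition capra_conjugate ::
    "(real ^ 'n \<Rightarrow> real) \<Rightarrow> (real ^ 'n \<Rightarrow> ereal) \<Rightarrow> real ^ 'n \<Rightarrow> ereal" where
  "capra_conjugate N f y = (SUP x. lower_add (ereal (capra N x y)) (- f x))"

definition capra_biconjugate ::
    "(real ^ 'n \<Rightarrow> real) \<Rightarrow> (real ^ 'n \<Rightarrow> ereal) \<Rightarrow> real ^ 'n \<Rightarrow> ereal" where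
  "capra_biconjugate N f x =
     (SUP y. lower_add (ereal (capra N x y)) (- capra_conjugate N f y))"

end

theory Submission
  imports Defs
begin

text \<open>
  On vectors with support \<open>K\<close> the pairing with \<open>y\<close> only sees \<open>y\<close> restricted to \<open>K\<close>, so the
  Capra coupling is bounded by the dual norm of that restriction. Grouping the supremum that
  defines the conjugate by the value \<open>j\<close> of \<open>l0\<close> therefore bounds it by the top-\<open>j\<close> dual norms.
  The reverse bound has two ingredients. For an orthant-monotonic norm, restricting a vector
  to \<open>K\<close> does not leave the unit ball, so the dual norm of the restriction of \<open>y\<close> to \<open>K\<close> is
  determined by vectors with \<open>l0\<close> at most \<open>j\<close>; and these are limits of vectors with \<open>l0\<close>
  exactly \<open>j\<close> (\<open>l0_le_in_closure\<close>), so a bound on the latter extends to the former.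

  For the biconjugate only the lower bound is an issue. At \<open>x \<noteq> 0\<close> take a functional \<open>y\<close> of
  dual norm at most 1 that attains \<open>N x\<close>. Strict monotonicity of \<open>N\<close> forces \<open>y\<close> to be nonzero
  on the whole support of \<open>x\<close>. Strict monotonicity of the dual norm then makes every
  restriction of \<open>y\<close> to fewer than \<open>l0 x\<close> coordinates have dual norm below 1, uniformly since
  there are finitely many such restrictions (\<open>norming_functional_gap\<close>). Hence the coupling
  with \<open>y\<close> is 1 at \<open>x\<close>, at most 1 everywhere, and bounded away from 1 on all vectors sparser
  than \<open>x\<close>. Multiplying \<open>y\<close> by a large factor makes that gap exceed the variation of \<open>\<phi>\<close>, while
  vectors at least as dense as \<open>x\<close> are dealt with by monotonicity of \<open>\<phi>\<close>.
\<close>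

section \<open>Norms and dual norms\<close>

lemma is_normD:
  assumes "is_norm N"
  shows "0 \<le> N x" "N x = 0 \<longleftrightarrow> x = 0" "N (c *\<^sub>R x) = \<bar>c\<bar> * N x" "N (x + y) \<le> N x + N y"
  using assms by (auto simp: is_norm_def)

lemma is_norm_pos: "is_norm N \<Longrightarrow> x \<noteq> 0 \<Longrightarrow> 0 < N x"
  using is_normD(1,2)[of N x] by linarith

lemma is_norm_continuous:
  fixes N :: "real ^ 'n \<Rightarrow> real"
  assumes "is_norm N"
  shows "continuous_on UNIV N"
proof (rule convex_on_continuous)
  show "convex_on UNIV N"
  proof (rule convex_onI)
    fix t :: real and x y :: "real ^ 'n"
    assume "0 < t" "t < 1"
    then show "N ((1 - t) *\<^sub>R x + t *\<^sub>R y) \<le> (1 - t) * N x + t * N y"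
      using is_normD(4)[OF assms, of "(1 - t) *\<^sub>R x" "t *\<^sub>R y"] by (simp add: is_normD(3)[OF assms])
  qed simp
qed simp

lemma norm_le_is_norm:
  fixes N :: "real ^ 'n \<Rightarrow> real"
  assumes N: "is_norm N"
  obtains C where "0 < C" "\<And>x. norm x \<le> C * N x"
proof -
  have "sphere (0 :: real ^ 'n) 1 \<noteq> {}" by simp
  then obtain z where z: "z \<in> sphere 0 1" and min: "\<And>x. x \<in> sphere 0 1 \<Longrightarrow> N z \<le> N x"
    using continuous_attains_inf[of "sphere 0 1" N] continuous_on_subset[OF is_norm_continuous[OF N]]
    by (meson compact_sphere subset_UNIV)
  have "z \<noteq> 0" using z by auto
  then have pos: "0 < N z" using is_norm_pos[OF N] by blast
  have "norm x \<le> (1 / N z) * N x" for x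
  proof (cases "x = 0")
    case False
    then have "N z \<le> N ((1 / norm x) *\<^sub>R x)" by (intro min) simp
    then show ?thesis using False pos by (simp add: is_normD(3)[OF N] field_simps)
  qed (use is_normD(2)[OF N, of 0] in simp)
  then show ?thesis using that[of "1 / N z"] pos by simp
qed

lemma inner_le_is_norm_dual_norm:
  assumes N: "is_norm N"
  shows "x \<bullet> y \<le> N x * dual_norm N y"
proof (cases "x = 0")
  case False
  obtain C where C: "0 < C" "\<And>x. norm x \<le> C * N x" using norm_le_is_norm[OF N] by blast
  have bdd: "bdd_above ((\<lambda>x. x \<bullet> y) ` {x. N x \<le> 1})"
  proof (rule bdd_aboveI2)
    fix x assume "x \<in> {x. N x \<le> 1}"
    then have "norm x \<le> C" using C(2)[of x] mult_left_mono[OF _ less_imp_le[OF C(1)], of "N x" 1] by simp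
    then show "x \<bullet> y \<le> C * norm y"
      using norm_cauchy_schwarz[of x y] mult_right_mono[of "norm x" C "norm y"] by simp
  qed
  have pos: "0 < N x" using is_norm_pos[OF N False] .
  have "((1 / N x) *\<^sub>R x) \<bullet> y \<le> dual_norm N y"
    unfolding dual_norm_def using pos by (intro cSUP_upper bdd) (simp add: is_normD(3)[OF N])
  then show ?thesis using pos by (simp add: field_simps)
qed (use is_normD(2)[OF N, of 0] in simp)

lemma dual_norm_le:
  assumes "is_norm N" "\<And>x. N x \<le> 1 \<Longrightarrow> x \<bullet> y \<le> B"
  shows "dual_norm N y \<le> B"
  unfolding dual_norm_def
proof (rule cSUP_least)
  have "N 0 \<le> 1" using is_normD(2)[OF assms(1), of 0] by simp
  then show "{x. N x \<le> 1} \<noteq> {}" by blast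
qed (use assms(2) in simp)

text \<open>This is Hahn-Banach in finite dimension: the functional comes from separating \<open>x\<close> from
  the open ball of radius \<open>N x\<close>.\<close>

lemma norming_functional:
  fixes N :: "real ^ 'n \<Rightarrow> real"
  assumes N: "is_norm N" and "x \<noteq> 0"
  obtains y where "x \<bullet> y = N x" "\<And>z. z \<bullet> y \<le> N z"
proof -
  let ?B = "{z. N z < N x}"
  have pos: "0 < N x" using is_norm_pos[OF N \<open>x \<noteq> 0\<close>] .
  have "convex ?B"
  proof (rule convexI)
    fix u v and s t :: real
    assume uv: "u \<in> ?B" "v \<in> ?B" and st: "0 \<le> s" "0 \<le> t" "s + t = 1"
    have "N (s *\<^sub>R u + t *\<^sub>R v) \<le> s * N u + t * N v"
      using is_normD(4)[OF N, of "s *\<^sub>R u" "t *\<^sub>R v"] st by (simp add: is_normD(3)[OF N])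
    also have "\<dots> < N x" using uv st convex_bound_lt[of "N u" "N x" "N v" s t] by simp
    finally show "s *\<^sub>R u + t *\<^sub>R v \<in> ?B" by simp
  qed
  moreover have "0 \<in> ?B" using pos is_normD(2)[OF N, of 0] by simp
  ultimately obtain a b where "a \<noteq> 0" and ball: "\<And>z. N z < N x \<Longrightarrow> a \<bullet> z \<le> b" and "b \<le> a \<bullet> x"
    using separating_hyperplane_sets[of ?B "{x}"] by auto
  then have ax: "a \<bullet> z \<le> a \<bullet> x" if "N z < N x" for z using that by fastforce
  \<comment> \<open>The separation is weak, so the homogeneous bound is a limit of its values at \<open>t < 1\<close>.\<close>
  have scaled: "(a \<bullet> z) * N x \<le> (a \<bullet> x) * N z" for z
  proof (cases "z = 0")
    case False
    have Nz: "0 < N z" using is_norm_pos[OF N False] .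
    have "t * ((a \<bullet> z) * N x) \<le> (a \<bullet> x) * N z" if "0 < t" "t < 1" for t
      using ax[of "(t * N x / N z) *\<^sub>R z"] that pos Nz
      by (simp add: is_normD(3)[OF N] field_simps)
    then show ?thesis by (rule field_le_mult_one_interval)
  qed (use is_normD(2)[OF N, of 0] in simp)
  have "0 < (a \<bullet> a) * N x" using \<open>a \<noteq> 0\<close> pos by simp
  then have "0 < (a \<bullet> x) * N a" using scaled[of a] by linarith
  then have axpos: "0 < a \<bullet> x" using is_normD(1)[OF N, of a] by (simp add: zero_less_mult_iff)
  show ?thesis
  proof (rule that[of "(N x / (a \<bullet> x)) *\<^sub>R a"])
    show "x \<bullet> ((N x / (a \<bullet> x)) *\<^sub>R a) = N x" using axpos by (simp add: inner_commute)
    show "z \<bullet> ((N x / (a \<bullet> x)) *\<^sub>R a) \<le> N z" for z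
      using axpos scaled[of z] by (simp add: inner_commute field_simps)
  qed
qed

section \<open>Restriction to coordinates\<close>

lemma vec_restrict_nth [simp]: "vec_restrict K y $ i = (if i \<in> K then y $ i else 0)"
  by (simp add: vec_restrict_def)

lemma inner_vec_restrict: "x \<bullet> vec_restrict K y = vec_restrict K x \<bullet> y"
  unfolding inner_vec_def by (rule sum.cong) auto

lemma vec_restrict_supp: "{i. x $ i \<noteq> 0} \<subseteq> K \<Longrightarrow> vec_restrict K x = x"
  by (auto simp: vec_eq_iff)

lemma l0_le_CARD: "l0 (x :: real ^ 'n) \<le> CARD('n)"
  unfolding l0_def by (rule card_mono) auto

lemma orthant_monotonic_vec_restrict:
  "orthant_monotonic N \<Longrightarrow> N (vec_restrict K x) \<le> N x"
  unfolding orthant_monotonic_def by simp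

lemma orthant_strictly_monotonic_vec_restrict:
  assumes "orthant_strictly_monotonic N" "i \<notin> K" "x $ i \<noteq> 0"
  shows "N (vec_restrict K x) < N x"
  using assms(1)[unfolded orthant_strictly_monotonic_def, rule_format, of "vec_restrict K x" x]
    assms(2,3) by fastforce

text \<open>Turning \<open>j - l0 x\<close> of the zero entries of \<open>x\<close> into a small \<open>t > 0\<close> gives the approximants.\<close>

lemma l0_le_in_closure:
  fixes x :: "real ^ 'n"
  assumes "l0 x \<le> j" "j \<le> CARD('n)"
  shows "x \<in> closure {z. l0 z = j}"
proof -
  let ?S = "{i. x $ i \<noteq> 0}"
  have "j - card ?S \<le> card (- ?S)" using assms by (simp add: l0_def Compl_eq_Diff_UNIV card_Diff_subset)
  then obtain L where L: "L \<subseteq> - ?S" "card L = j - card ?S"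
    using obtain_subset_with_card_n by metis
  define z where "z n = x + inverse (real (Suc n)) *\<^sub>R vec_restrict L (\<chi> i. 1)" for n
  have "{i. z n $ i \<noteq> 0} = ?S \<union> L" for n
    using L(1) by (auto simp: z_def)
  moreover have "card (?S \<union> L) = j"
    using L assms(1) by (subst card_Un_disjoint) (auto simp: l0_def)
  ultimately have "\<forall>n. z n \<in> {z. l0 z = j}" by (simp add: l0_def)
  moreover have "z \<longlonglongrightarrow> x + 0 *\<^sub>R vec_restrict L (\<chi> i. 1)"
    unfolding z_def by (intro tendsto_intros LIMSEQ_inverse_real_of_nat)
  ultimately show ?thesis unfolding closure_sequential by auto
qed

section \<open>The Capra conjugate of a function of the support size\<close>

lemma lower_add_ereal [simp]: "lower_add (ereal a) (ereal b) = ereal (a + b)"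
  by (simp add: lower_add_def)

lemma capra_le_dual_norm_vec_restrict:
  assumes N: "is_norm N" and "x \<noteq> 0"
  shows "capra N x y \<le> dual_norm N (vec_restrict {i. x $ i \<noteq> 0} y)"
proof -
  have "x \<bullet> y \<le> N x * dual_norm N (vec_restrict {i. x $ i \<noteq> 0} y)"
    using inner_le_is_norm_dual_norm[OF N, of x "vec_restrict {i. x $ i \<noteq> 0} y"]
    by (simp add: inner_vec_restrict vec_restrict_supp)
  then show ?thesis using is_norm_pos[OF N \<open>x \<noteq> 0\<close>] \<open>x \<noteq> 0\<close> by (simp add: capra_def field_simps)
qed

lemma capra_le_top_dual_norm:
  fixes N :: "real ^ 'n \<Rightarrow> real"
  assumes N: "is_norm N"
  shows "capra N x y \<le> top_dual_norm N (l0 x) y"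
proof (cases "x = 0")
  case True
  then show ?thesis by (simp add: capra_def top_dual_norm_def l0_def)
next
  case False
  then have "l0 x \<noteq> 0" by (auto simp: l0_def vec_eq_iff)
  moreover have "dual_norm N (vec_restrict {i. x $ i \<noteq> 0} y)
      \<le> (SUP K\<in>{K. card K \<le> l0 x}. dual_norm N (vec_restrict K y))"
    by (rule cSUP_upper) (auto simp: l0_def)
  ultimately show ?thesis
    using capra_le_dual_norm_vec_restrict[OF N False, of y] by (simp add: top_dual_norm_def)
qed

lemma top_dual_norm_le:
  fixes N :: "real ^ 'n \<Rightarrow> real"
  assumes N: "is_norm N" and mono: "orthant_monotonic N" and j: "j \<le> CARD('n)"
    and bound: "\<And>z. l0 z = j \<Longrightarrow> capra N z y \<le> B"
  shows "top_dual_norm N j y \<le> B"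
proof (cases "j = 0")
  case True
  then show ?thesis using bound[of 0] by (simp add: top_dual_norm_def l0_def capra_def)
next
  case False
  have exact: "z \<bullet> y \<le> B * N z" if "l0 z = j" for z
  proof -
    have "z \<noteq> 0" using that False by (auto simp: l0_def)
    then show ?thesis
      using bound[OF that] is_norm_pos[OF N] by (simp add: capra_def field_simps)
  qed
  have "closed {z. z \<bullet> y \<le> B * N z}"
    by (intro closed_Collect_le continuous_intros is_norm_continuous[OF N])
  then have "closure {z. l0 z = j} \<subseteq> {z. z \<bullet> y \<le> B * N z}"
    using exact by (intro closure_minimal) auto
  then have sparse: "z \<bullet> y \<le> B * N z" if "l0 z \<le> j" for z
    using l0_le_in_closure[OF that j] by blast
  \<comment> \<open>A vector and its opposite have the same \<open>l0\<close>, so \<open>B\<close> bounds a number and its negative.\<close>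
  have "0 \<le> B"
  proof -
    obtain S :: "'n set" where S: "card S = j"
      using obtain_subset_with_card_n[OF j] by blast
    define z :: "real ^ 'n" where "z = vec_restrict S (\<chi> i. 1)"
    have supp: "l0 z = j" "l0 (- z) = j" using S by (simp_all add: l0_def z_def)
    have "N (- z) = N z" using is_normD(3)[OF N, of "-1" z] by simp
    then have "0 \<le> B * N z" using exact[OF supp(1)] exact[OF supp(2)] by simp
    moreover have "z \<noteq> 0" using supp(1) False by (auto simp: l0_def)
    ultimately show ?thesis using is_norm_pos[OF N, of z] by (simp add: zero_le_mult_iff)
  qed
  have "dual_norm N (vec_restrict K y) \<le> B" if "card K \<le> j" for K
  proof (rule dual_norm_le[OF N])
    fix x assume x: "N x \<le> 1"
    have "l0 (vec_restrict K x) \<le> card K" unfolding l0_def by (rule card_mono) auto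
    then have "x \<bullet> vec_restrict K y \<le> B * N (vec_restrict K x)"
      using sparse that by (simp add: inner_vec_restrict)
    also have "\<dots> \<le> B * 1"
      using orthant_monotonic_vec_restrict[OF mono, of K x] x \<open>0 \<le> B\<close> by (intro mult_left_mono) auto
    finally show "x \<bullet> vec_restrict K y \<le> B" by simp
  qed
  moreover have "{K :: 'n set. card K \<le> j} \<noteq> {}" by (auto intro: exI[of _ "{}"])
  ultimately show ?thesis using False by (auto simp: top_dual_norm_def intro!: cSUP_least)
qed

lemma capra_conjugate_l0:
  fixes N :: "real ^ 'n \<Rightarrow> real"
  assumes N: "is_norm N" and mono: "orthant_monotonic N"
  shows "capra_conjugate N (\<lambda>x. ereal (\<phi> (l0 x))) y
    = (SUP j\<in>{0..CARD('n)}. ereal (top_dual_norm N j y - \<phi> j))" (is "?C = ?S")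
proof (rule antisym)
  show "?C \<le> ?S"
    unfolding capra_conjugate_def
  proof (rule SUP_least)
    fix x
    show "lower_add (ereal (capra N x y)) (- ereal (\<phi> (l0 x))) \<le> ?S"
      using capra_le_top_dual_norm[OF N, of x y] l0_le_CARD[of x]
      by (intro SUP_upper2[of "l0 x"]) auto
  qed
next
  have le: "ereal (capra N z y - \<phi> (l0 z)) \<le> ?C" for z
    unfolding capra_conjugate_def by (rule SUP_upper2[of z]) auto
  show "?S \<le> ?C"
  proof (rule SUP_least)
    fix j assume "j \<in> {0..CARD('n)}"
    then have j: "j \<le> CARD('n)" by simp
    show "ereal (top_dual_norm N j y - \<phi> j) \<le> ?C"
    proof (cases ?C)
      case (real c)
      have "capra N z y \<le> c + \<phi> j" if "l0 z = j" for z
        using le[of z] real that by simp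
      then show ?thesis using top_dual_norm_le[OF N mono j] real by (simp add: diff_le_eq)
    qed (use le[of 0] in auto)
  qed
qed

section \<open>The Capra biconjugate of a function of the support size\<close>

lemma capra_biconjugate_le: "capra_biconjugate N (\<lambda>x. ereal (f x)) x \<le> ereal (f x)"
  unfolding capra_biconjugate_def
proof (rule SUP_least)
  fix y
  let ?C = "capra_conjugate N (\<lambda>x. ereal (f x)) y"
  have "ereal (capra N x y - f x) \<le> ?C"
    unfolding capra_conjugate_def by (rule SUP_upper2[of x]) auto
  then show "lower_add (ereal (capra N x y)) (- ?C) \<le> ereal (f x)"
    by (cases ?C) (auto simp: lower_add_def)
qed

text \<open>A point \<open>y\<close> certifies a lower bound for the biconjugate at \<open>x\<close> when \<open>x\<close> maximises
  \<open>capra N z y - f z\<close>, that is, when \<open>y\<close> is a Capra subgradient of \<open>f\<close> at \<open>x\<close>.\<close>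

lemma capra_biconjugate_eq_of_subgradient:
  assumes "\<And>z. capra N z y - f z \<le> capra N x y - f x"
  shows "capra_biconjugate N (\<lambda>x. ereal (f x)) x = ereal (f x)"
proof (rule antisym[OF capra_biconjugate_le])
  have "capra_conjugate N (\<lambda>x. ereal (f x)) y = ereal (capra N x y - f x)"
    unfolding capra_conjugate_def using assms
    by (intro antisym SUP_least SUP_upper2[of x]) auto
  then show "ereal (f x) \<le> capra_biconjugate N (\<lambda>x. ereal (f x)) x"
    unfolding capra_biconjugate_def by (intro SUP_upper2[of y]) simp_all
qed

lemma capra_scaleR_right: "capra N x (c *\<^sub>R y) = c * capra N x y"
  by (simp add: capra_def)

text \<open>Were a norming functional \<open>y\<close> zero at a coordinate \<open>i\<close> in the support of \<open>x\<close>, deleting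
  that coordinate from \<open>x\<close> would decrease \<open>N x\<close> but not the pairing with \<open>y\<close>. So \<open>y\<close> has no
  zero on the support of \<open>x\<close>, and any set with fewer than \<open>l0 x\<close> elements misses a nonzero
  entry of \<open>y\<close>.\<close>

lemma norming_functional_gap:
  fixes N :: "real ^ 'n \<Rightarrow> real"
  assumes N: "is_norm N" and "x \<noteq> 0"
    and strict: "orthant_strictly_monotonic N" "orthant_strictly_monotonic (dual_norm N)"
  obtains y q where "capra N x y = 1" "\<And>z. capra N z y \<le> 1" "q < 1"
    "\<And>z. l0 z < l0 x \<Longrightarrow> capra N z y \<le> q"
proof -
  obtain y where xy: "x \<bullet> y = N x" and le: "\<And>z. z \<bullet> y \<le> N z"
    using norming_functional[OF N \<open>x \<noteq> 0\<close>] by blast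
  have nonzero: "y $ i \<noteq> 0" if "x $ i \<noteq> 0" for i
  proof
    assume "y $ i = 0"
    then have "vec_restrict (- {i}) x \<bullet> y = x \<bullet> y"
      unfolding inner_vec_def by (intro sum.cong) auto
    then have "N x \<le> N (vec_restrict (- {i}) x)" using le[of "vec_restrict (- {i}) x"] xy by simp
    then show False
      using orthant_strictly_monotonic_vec_restrict[OF strict(1), of i "- {i}" x] that by simp
  qed
  have dual: "dual_norm N y \<le> 1" using le by (intro dual_norm_le[OF N]) (meson order_trans)
  have small: "dual_norm N (vec_restrict J y) < 1" if J: "card J < l0 x" for J
  proof -
    have "\<not> {i. x $ i \<noteq> 0} \<subseteq> J" using J card_mono[of J "{i. x $ i \<noteq> 0}"] by (auto simp: l0_def)
    then obtain i where "i \<notin> J" "x $ i \<noteq> 0" by blast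
    then show ?thesis
      using orthant_strictly_monotonic_vec_restrict[OF strict(2), of i J y] nonzero dual by fastforce
  qed
  \<comment> \<open>Inserting 0 covers the vector \<open>z = 0\<close>, where the coupling is 0 by definition.\<close>
  define A where "A = insert 0 ((\<lambda>J. dual_norm N (vec_restrict J y)) ` {J. card J < l0 x})"
  have "finite A" "A \<noteq> {}" by (auto simp: A_def)
  then have "Max A < 1" using small by (auto simp: A_def)
  show ?thesis
  proof (rule that[of y "Max A"])
    show "capra N x y = 1" using xy is_norm_pos[OF N \<open>x \<noteq> 0\<close>] \<open>x \<noteq> 0\<close> by (simp add: capra_def)
    show "capra N z y \<le> 1" for z using le[of z] is_norm_pos[OF N, of z] by (simp add: capra_def)
    show "Max A < 1" by fact
    show "capra N z y \<le> Max A" if z: "l0 z < l0 x" for z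
    proof (cases "z = 0")
      case True
      then show ?thesis using \<open>finite A\<close> by (simp add: capra_def A_def)
    next
      case False
      have "dual_norm N (vec_restrict {i. z $ i \<noteq> 0} y) \<in> A" using z by (auto simp: A_def l0_def)
      then show ?thesis
        using capra_le_dual_norm_vec_restrict[OF N False, of y] Max_ge[OF \<open>finite A\<close>] order_trans by blast
    qed
  qed
qed

lemma capra_biconjugate_l0:
  fixes N :: "real ^ 'n \<Rightarrow> real"
  assumes N: "is_norm N"
    and strict: "orthant_strictly_monotonic N" "orthant_strictly_monotonic (dual_norm N)"
    and \<phi>: "mono_on {0..CARD('n)} \<phi>"
  shows "capra_biconjugate N (\<lambda>x. ereal (\<phi> (l0 x))) x = ereal (\<phi> (l0 x))"
proof -
  have mono: "\<phi> i \<le> \<phi> (l0 z)" if "i \<le> l0 z" for i and z :: "real ^ 'n"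
    using \<phi> that l0_le_CARD[of z] by (auto intro: mono_onD)
  show ?thesis
  proof (cases "x = 0")
    case True
    then show ?thesis
      using mono[of 0] by (intro capra_biconjugate_eq_of_subgradient[of N 0]) (simp add: capra_def l0_def)
  next
    case False
    obtain y q where y: "capra N x y = 1" "\<And>z. capra N z y \<le> 1"
      and q: "q < 1" "\<And>z. l0 z < l0 x \<Longrightarrow> capra N z y \<le> q"
      using norming_functional_gap[OF N False strict] by blast
    \<comment> \<open>The factor for which the gap \<open>1 - q\<close> becomes the largest possible drop of \<open>\<phi>\<close> below \<open>x\<close>.\<close>
    define c where "c = (\<phi> (l0 x) - \<phi> 0) / (1 - q)"
    have c: "0 \<le> c" "c * (1 - q) = \<phi> (l0 x) - \<phi> 0"
      using mono[of 0 x] q(1) by (auto simp: c_def)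
    show ?thesis
    proof (rule capra_biconjugate_eq_of_subgradient[of N "c *\<^sub>R y"])
      fix z
      have "c * capra N z y - \<phi> (l0 z) \<le> c - \<phi> (l0 x)"
      proof (cases "l0 z < l0 x")
        case True
        then have "c * capra N z y \<le> c * q" using q(2) c(1) by (intro mult_left_mono)
        then show ?thesis using c(2) mono[of 0 z] by (simp add: algebra_simps)
      next
        case False
        then have "\<phi> (l0 x) \<le> \<phi> (l0 z)" by (intro mono) simp
        moreover have "c * capra N z y \<le> c * 1" using y(2) c(1) by (intro mult_left_mono)
        ultimately show ?thesis by simp
      qed
      then show "capra N z (c *\<^sub>R y) - \<phi> (l0 z) \<le> capra N x (c *\<^sub>R y) - \<phi> (l0 x)"
        by (simp add: capra_scaleR_right y(1))
    qed
  qed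
qed

theorem theorem8:
  fixes N :: "real ^ 'n \<Rightarrow> real"
  assumes "is_norm N"
  shows "(orthant_monotonic N \<longrightarrow>
           (\<forall>\<phi> :: nat \<Rightarrow> real.
              capra_conjugate N (\<lambda>x. ereal (\<phi> (l0 x))) =
              (\<lambda>y. SUP j\<in>{0..CARD('n)}. ereal (top_dual_norm N j y - \<phi> j))))
       \<and> (orthant_strictly_monotonic N \<and> orthant_strictly_monotonic (dual_norm N) \<longrightarrow>
           (\<forall>\<phi> :: nat \<Rightarrow> real. mono_on {0..CARD('n)} \<phi> \<longrightarrow>
              capra_biconjugate N (\<lambda>x. ereal (\<phi> (l0 x))) = (\<lambda>x. ereal (\<phi> (l0 x)))))"
proof (intro conjI impI allI ext)
  fix \<phi> :: "nat \<Rightarrow> real" and y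
  assume "orthant_monotonic N"
  then show "capra_conjugate N (\<lambda>x. ereal (\<phi> (l0 x))) y
      = (SUP j\<in>{0..CARD('n)}. ereal (top_dual_norm N j y - \<phi> j))"
    by (rule capra_conjugate_l0[OF assms])
next
  fix \<phi> :: "nat \<Rightarrow> real" and x
  assume "orthant_strictly_monotonic N \<and> orthant_strictly_monotonic (dual_norm N)"
    and "mono_on {0..CARD('n)} \<phi>"
  then show "capra_biconjugate N (\<lambda>x. ereal (\<phi> (l0 x))) x = ereal (\<phi> (l0 x))"
    by (intro capra_biconjugate_l0[OF assms]) simp_all
qed

end
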